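(* Let $n,t\in\mathbb N$, let $G\subseteq\operatorname{Sym}\mathbb R[\bar X]^{t\times t}$ be a (possibly infinite) set of symmetric matrix polynomials, and suppose that the quadratic module $M_G$ is archimedean. For $f\in\operatorname{Sym}\mathbb R[\bar X]^{t\times t}$, the following are equivalent: (i) for every $x\in S_G$, the matrix $f(x)$ is not negative semidefinite; (ii) there exist finitely many $p_i\in\mathbb R[\bar X]^{t\times t}$ such that $$\sum_ip_i^*fp_i\in 1+M_G.$$
   Context: $\mathbb N=\{1,2,\dots\}$. $\mathbb R[\bar X]$ is the (commutative) polynomial ring in $n$ variables $\bar X=(X_1,\dots,X_n)$. $\mathbb R[\bar X]^{t\times t}$ is the ring of $t\times t$ matrices over $\mathbb R[\bar X]$ with involution $*$ the transpose, and $\operatorname{Sym}\mathbb R[\bar X]^{t\times t}=\{p\in\mathbb R[\bar X]^{t\times t}\mid p=p^*\}$. $1$ denotes the identity matrix, and scalars are identified with scalar multiples of it. For a symmetric real matrix $A$, $A\succeq0$ means $A$ is positive semidefinite; $A$ is negative semidefinite if $-A\succeq0$. For $G\subseteq\operatorname{Sym}\mathbb R[\bar X]^{t\times t}$: $S_G=\{x\in\mathbb R^n\mid g(x)\succeq0\text{ for all }g\in G\}$, and $M_G=\{\sum_{i=1}^Np_i^*g_ip_i\mid N\in\mathbb N,\ g_i\in\{1\}\cup G,\ p_i\in\mathbb R[\bar X]^{t\times t}\}$ (the quadratic module generated by $G$). $M_G$ is archimedean if for every $a\in\mathbb R[\bar X]^{t\times t}$ there is $N\in\mathbb N$ with $N-a^*a\in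 M_G$. *)

theory Defs
  imports "HOL-Analysis.Analysis" "HOL-Library.Poly_Mapping"
begin

text \<open>The number of variables \<open>n\<close> and the matrix size \<open>t\<close> are arbitrary but fixed, so
  they are the cardinalities of finite index types \<open>'n\<close> and \<open>'t\<close>. A polynomial is a finitely
  supported map from exponent vectors to real coefficients; its product is convolution.\<close>

type_synonym 'n mpoly = "('n \<Rightarrow>\<^sub>0 nat) \<Rightarrow>\<^sub>0 real"

type_synonym ('n, 't) mpoly_matrix = "'n mpoly ^ 't ^ 't"

definition poly_eval :: "real ^ 'n \<Rightarrow> 'n::finite mpoly \<Rightarrow> real" where
  "poly_eval x p =
     (\<Sum>m\<in>Poly_Mapping.keys p. Poly_Mapping.lookup p m * (\<Prod>i\<in>UNIV. (x $ i) ^ Poly_Mapping.lookup m i))"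

definition matrix_eval ::
  "('n::finite, 't::finite) mpoly_matrix \<Rightarrow> real ^ 'n \<Rightarrow> real ^ 't ^ 't" where
  "matrix_eval p x = map_matrix (poly_eval x) p"

definition Sym :: "('a ^ 't ^ 't::finite) set" where
  "Sym = {p. transpose p = p}"

definition pos_semidef :: "real ^ 't ^ 't::finite \<Rightarrow> bool" where
  "pos_semidef A \<longleftrightarrow> A \<in> Sym \<and> (\<forall>v. 0 \<le> v \<bullet> (A *v v))"

definition neg_semidef :: "real ^ 't ^ 't::finite \<Rightarrow> bool" where
  "neg_semidef A \<longleftrightarrow> pos_semidef (- A)"

definition nonneg_set :: "('n::finite, 't::finite) mpoly_matrix set \<Rightarrow> (real ^ 'n) set" where
  "nonneg_set G = {x. \<forall>g\<in>G. pos_semidef (matrix_eval g x)}"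

definition quadratic_module ::
  "('n::finite, 't::finite) mpoly_matrix set \<Rightarrow> ('n, 't) mpoly_matrix set" where
  "quadratic_module G =
     {(\<Sum>i=1..N. transpose (p i) ** g i ** p i) | (N::nat) g p.
        1 \<le> N \<and> (\<forall>i\<in>{1..N}. g i \<in> insert (mat 1) G)}"

text \<open>The ring unit of the matrix ring is \<open>mat 1\<close> (the constant \<open>1\<close> of the vector type would be
  the all-ones matrix), and the scalar \<open>N\<close> is \<open>mat (of_nat N)\<close>.\<close>

definition archimedean_module :: "('n::finite, 't::finite) mpoly_matrix set \<Rightarrow> bool" where
  "archimedean_module M \<longleftrightarrow>
     (\<forall>a :: ('n, 't) mpoly_matrix. \<exists>N::nat. 1 \<le> N \<and> mat (of_nat N) - transpose a ** a \<in> M)"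

end

theory Submission imports Defs
begin

text \<open>
  For the nontrivial direction, \<open>K = {m - \<Sum> p\<^sub>i\<^sup>* f p\<^sub>i | m \<in> M\<^sub>G}\<close> is again an archimedean
  quadratic module, and (ii) says that \<open>-1 \<in> K\<close>. Suppose \<open>-1 \<notin> K\<close>. The polynomials \<open>a\<close> whose
  scalar matrix lies in \<open>K\<close> form a proper archimedean quadratic module of \<open>\<real>[X]\<close>. A maximal proper
  quadratic module containing it, in the sense of Zorn, is total, so every polynomial is
  infinitesimally close to exactly one real number; this defines a ring homomorphism to the reals,
  hence the evaluation at a point \<open>x\<close>. For \<open>g \<in> K\<close> and a real vector \<open>v\<close> the scalar matrix
  \<open>v\<^sup>* g v = \<Sum>\<^sub>j (v e\<^sub>j\<^sup>*)\<^sup>* g (v e\<^sub>j\<^sup>*)\<close> lies in \<open>K\<close>, so \<open>g(x) \<succeq> 0\<close>. Thus \<open>x \<in> S\<^sub>G\<close> and \<open>f(x)\<close> is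
  negative semidefinite.
\<close>

section \<open>Maximal quadratic modules of commutative rings\<close>

text \<open>Quadratic modules of a commutative ring. Properness is not an axiom, because an
  extension of a maximal proper cone has to be a cone even when it contains
  \<open>- 1\<close>.\<close>

locale square_cone =
  fixes M :: "'a::comm_ring_1 set"
  assumes one_mem: "1 \<in> M"
    and add_mem: "a \<in> M \<Longrightarrow> b \<in> M \<Longrightarrow> a + b \<in> M"
    and square_mem: "a \<in> M \<Longrightarrow> q\<^sup>2 * a \<in> M"
begin

lemma zero_mem: "0 \<in> M"
  using square_mem[OF one_mem, of 0] by simp

text \<open>Takes the place of the sums of squares in the usual extension of \<open>M\<close> by an
  element \<open>a\<close>: it contains all squares and is closed under addition. Members act on
  \<open>M\<close>, so products like \<open>s * m'\<close> stay in \<open>M\<close> although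
  \<open>M\<close> need not be closed under multiplication.\<close>

definition multipliers :: "'a set" where
  "multipliers = {s. \<forall>a\<in>M. s * a \<in> M}"

lemma multipliers_subset: "s \<in> multipliers \<Longrightarrow> s \<in> M"
  using one_mem by (force simp: multipliers_def)

lemma square_cone_extend: "square_cone {m + s * a | m s. m \<in> M \<and> s \<in> multipliers}" (is "square_cone ?E")
proof
  have "0 \<in> multipliers"
    using zero_mem by (simp add: multipliers_def)
  then show "1 \<in> ?E"
    using one_mem by force
  show "x + y \<in> ?E" if "x \<in> ?E" "y \<in> ?E" for x y
  proof -
    obtain m s m' s' where *: "m \<in> M" "s \<in> multipliers" "m' \<in> M" "s' \<in> multipliers"
      and xy: "x = m + s * a" "y = m' + s' * a"
      using \<open>x \<in> ?E\<close> \<open>y \<in> ?E\<close> by blast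
    have "x + y = (m + m') + (s + s') * a"
      by (simp add: xy algebra_simps)
    moreover have "m + m' \<in> M" "s + s' \<in> multipliers"
      using * by (auto simp: multipliers_def distrib_right add_mem)
    ultimately show ?thesis
      by blast
  qed
  show "q\<^sup>2 * x \<in> ?E" if "x \<in> ?E" for x q
  proof -
    obtain m s where *: "m \<in> M" "s \<in> multipliers" and x: "x = m + s * a"
      using \<open>x \<in> ?E\<close> by blast
    have "q\<^sup>2 * x = q\<^sup>2 * m + (q\<^sup>2 * s) * a"
      by (simp add: x algebra_simps)
    moreover have "q\<^sup>2 * m \<in> M" "q\<^sup>2 * s \<in> multipliers"
      using * by (auto simp: multipliers_def mult.assoc square_mem)
    ultimately show ?thesis
      by blast
  qed
qed

text \<open>With 2 invertible, \<open>a\<close> is the difference of the squares of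
  \<open>h * (a + 1)\<close> and \<open>h * (a - 1)\<close>. Hence the support, the intersection of
  \<open>M\<close> and \<open>- M\<close>, absorbs multiplication by every ring element.\<close>

lemma ideal_mem:
  assumes "2 * h = (1::'a)" "s \<in> M" "- s \<in> M"
  shows "s * a \<in> M"
proof -
  have "(h * (a + 1))\<^sup>2 * s + (h * (a - 1))\<^sup>2 * (- s) = (2 * h)\<^sup>2 * (s * a)"
    by (simp add: power2_eq_square algebra_simps)
  then show ?thesis
    using add_mem[OF square_mem[OF assms(2)] square_mem[OF assms(3)]] assms(1)
    by (metis mult_1 one_power2)
qed

text \<open>If neither sign of \<open>a\<close> lies in \<open>M\<close>, adjoining either one
  produces \<open>- 1\<close>. Combining the two relations puts the coefficient \<open>s\<close>
  into the support of \<open>M\<close>, so \<open>s * a\<close> is in \<open>M\<close> and already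
  \<open>- 1 = m + s * a\<close> is, contradicting properness.\<close>

lemma maximal_total:
  assumes "2 * h = (1::'a)" and proper: "- 1 \<notin> M"
    and maximal: "\<And>N. square_cone N \<Longrightarrow> M \<subseteq> N \<Longrightarrow> - 1 \<notin> N \<Longrightarrow> N = M"
  shows "a \<in> M \<or> - a \<in> M"
proof (rule ccontr)
  assume not_mem: "\<not> (a \<in> M \<or> - a \<in> M)"
  have one_mult: "1 \<in> multipliers" and zero_mult: "0 \<in> multipliers"
    using zero_mem by (auto simp: multipliers_def)
  have ext: "\<exists>m\<in>M. \<exists>s\<in>multipliers. - 1 = m + s * b" if "b \<notin> M" for b
  proof (rule ccontr)
    assume contra: "\<not> ?thesis"
    let ?E = "{m + s * b | m s. m \<in> M \<and> s \<in> multipliers}"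
    have "M \<subseteq> ?E"
      using zero_mult by force
    moreover have "- 1 \<notin> ?E"
      using contra by blast
    ultimately have "?E = M"
      using maximal square_cone_extend by blast
    moreover have "0 + 1 * b \<in> ?E"
      using one_mult zero_mem by blast
    ultimately show False
      using that by simp
  qed
  obtain m s where ms: "m \<in> M" "s \<in> multipliers" "- 1 = m + s * a"
    using ext not_mem by blast
  obtain m' s' where ms': "m' \<in> M" "s' \<in> multipliers" "- 1 = m' + s' * (- a)"
    using ext not_mem by blast
  have "s' * m \<in> M" "s * m' \<in> M"
    using ms(1,2) ms'(1,2) by (auto simp: multipliers_def)
  moreover have "s' \<in> M" "s \<in> M"
    using ms(2) ms'(2) multipliers_subset by blast+
  ultimately have "s' + s' * m + s * m' \<in> M"
    by (intro add_mem)
  \<comment> \<open>Multiplying the relation for \<open>a\<close> by \<open>s'\<close> and the one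
    for \<open>- a\<close> by \<open>s\<close> makes the terms in \<open>s * s' * a\<close>
    cancel.\<close>
  moreover have "s' + s' * m + s * m' = - s"
  proof -
    have m: "m = - 1 - s * a" and m': "m' = - 1 - s' * (- a)"
      by (metis ms(3) add_diff_cancel_right') (metis ms'(3) add_diff_cancel_right')
    show ?thesis
      unfolding m m' by (simp add: algebra_simps)
  qed
  ultimately have "s * a \<in> M"
    using ideal_mem[OF assms(1) \<open>s \<in> M\<close>] by metis
  then show False
    using ms proper add_mem by metis
qed

end

text \<open>Zorn's lemma applies since any two elements of the union of a chain lie in a common
  member, and \<open>- 1\<close> lies in no member.\<close>

lemma exists_maximal_square_cone:
  assumes "square_cone M" "- 1 \<notin> M"
  obtains N where "square_cone N" "M \<subseteq> N" "- 1 \<notin> N"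
    "\<And>L. square_cone L \<Longrightarrow> N \<subseteq> L \<Longrightarrow> - 1 \<notin> L \<Longrightarrow> L = N"
proof -
  let ?A = "{N. square_cone N \<and> M \<subseteq> N \<and> - 1 \<notin> N}"
  have "\<exists>N\<in>?A. \<forall>L\<in>?A. N \<subseteq> L \<longrightarrow> L = N"
  proof (rule subset_Zorn_nonempty)
    show "?A \<noteq> {}"
      using assms by blast
    show "\<Union>C \<in> ?A" if "C \<noteq> {}" and chain: "subset.chain ?A C" for C
    proof -
      have C: "C \<subseteq> ?A"
        using chain by (simp add: subset.chain_def)
      have "square_cone (\<Union>C)"
      proof
        show "1 \<in> \<Union>C"
          using C \<open>C \<noteq> {}\<close> square_cone.one_mem by fastforce
        show "a + b \<in> \<Union>C" if "a \<in> \<Union>C" "b \<in> \<Union>C" for a b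
        proof -
          obtain A B where AB: "A \<in> C" "a \<in> A" "B \<in> C" "b \<in> B"
            using \<open>a \<in> \<Union>C\<close> \<open>b \<in> \<Union>C\<close> by blast
          then have "A \<subseteq> B \<or> B \<subseteq> A"
            using chain by (simp add: subset_chain_def)
          then obtain D where "D \<in> C" "a \<in> D" "b \<in> D"
            using AB by blast
          then show ?thesis
            using C square_cone.add_mem by blast
        qed
        show "q\<^sup>2 * a \<in> \<Union>C" if "a \<in> \<Union>C" for a q
          using C that square_cone.square_mem by blast
      qed
      then show ?thesis
        using C \<open>C \<noteq> {}\<close> by blast
    qed
  qed
  then obtain N where "N \<in> ?A" and N: "\<forall>L\<in>?A. N \<subseteq> L \<longrightarrow> L = N" ..
  show thesis
  proof (rule that[of N])
    show "L = N" if "square_cone L" "N \<subseteq> L" "- 1 \<notin> L" for L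
      using that \<open>N \<in> ?A\<close> by (intro N[rule_format]) auto
  qed (use \<open>N \<in> ?A\<close> in auto)
qed

section \<open>The homomorphism of a total archimedean cone\<close>

text \<open>The map \<open>c\<close> embeds the real constants. The axiom \<open>bounded\<close>
  gives upper bounds only; applied to \<open>- a\<close> it also yields lower bounds.\<close>

locale total_archimedean_cone = square_cone M for M :: "'a::comm_ring_1 set" +
  fixes c :: "real \<Rightarrow> 'a"
  assumes c_add: "c (r + s) = c r + c s"
    and c_mult: "c (r * s) = c r * c s"
    and c_one: "c 1 = 1"
    and proper: "- 1 \<notin> M"
    and total: "a \<in> M \<or> - a \<in> M"
    and bounded: "\<exists>B. c B - a \<in> M"
begin

lemma c_zero: "c 0 = 0"
  using c_add[of 0 0] by simp

lemma c_minus: "c (- r) = - c r"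
  using c_add[of r "- r"] c_zero by (simp add: eq_neg_iff_add_eq_0 add.commute)

lemma c_diff: "c (r - s) = c r - c s"
  using c_add[of r "- s"] c_minus by simp

text \<open>A nonnegative constant is the square of the constant \<open>c (sqrt r)\<close>.\<close>

lemma scale_mem: "0 \<le> r \<Longrightarrow> a \<in> M \<Longrightarrow> c r * a \<in> M"
  using square_mem[of a "c (sqrt r)"] c_mult[of "sqrt r" "sqrt r"] by (simp add: power2_eq_square)

lemma c_mem_iff: "c r \<in> M \<longleftrightarrow> 0 \<le> r"
proof
  show "0 \<le> r" if "c r \<in> M"
  proof (rule ccontr)
    assume "\<not> 0 \<le> r"
    \<comment> \<open>The positive factor \<open>- 1 / r\<close> normalises a negative constant to
      \<open>- 1\<close>.\<close>
    then have "c (- 1 / r) * c r \<in> M"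
      using that by (intro scale_mem) auto
    then show False
      using proper \<open>\<not> 0 \<le> r\<close> c_minus[of 1] c_one by (simp flip: c_mult)
  qed
  show "c r \<in> M" if "0 \<le> r"
    using scale_mem[OF that one_mem] by simp
qed

text \<open>Reads r - e \<le> a \<le> r + e for all e > 0, where x \<le> y means that y - x lies in
  \<open>M\<close>. As a relation it is compatible with the ring operations without choosing values;
  existence of \<open>r\<close> will be needed only for the variables.\<close>

definition near :: "'a \<Rightarrow> real \<Rightarrow> bool" where
  "near a r \<longleftrightarrow> (\<forall>e>0. c e + (c r - a) \<in> M \<and> c e - (c r - a) \<in> M)"

lemma near_upper: "near a r \<Longrightarrow> 0 < e \<Longrightarrow> c e + (c r - a) \<in> M"
  and near_lower: "near a r \<Longrightarrow> 0 < e \<Longrightarrow> c e - (c r - a) \<in> M"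
  by (simp_all add: near_def)

lemma near_c: "near (c r) r"
  by (simp add: near_def c_mem_iff)

lemma near_iff_zero: "near a r \<longleftrightarrow> near (a - c r) 0"
  by (auto simp: near_def c_zero algebra_simps)

lemma near_add:
  assumes "near a r" "near b s"
  shows "near (a + b) (r + s)"
  unfolding near_def
proof (intro allI impI)
  fix e :: real
  assume "0 < e"
  then have h: "0 < e / 2" and ce: "c e = c (e / 2) + c (e / 2)"
    by (simp_all flip: c_add)
  have "c (e / 2) + (c r - a) + (c (e / 2) + (c s - b)) \<in> M"
    "c (e / 2) - (c r - a) + (c (e / 2) - (c s - b)) \<in> M"
    using assms h by (simp_all only: add_mem near_upper near_lower)
  then show "c e + (c (r + s) - (a + b)) \<in> M \<and> c e - (c (r + s) - (a + b)) \<in> M"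
    by (simp add: ce c_add algebra_simps)
qed

lemma near_minus: "near a r \<Longrightarrow> near (- a) (- r)"
  by (auto simp: near_def c_minus algebra_simps)

lemma near_scale_pos:
  assumes "near a r" "0 < t"
  shows "near (c t * a) (t * r)"
  unfolding near_def
proof (intro allI impI)
  fix e :: real
  assume "0 < e"
  then have "0 < e / t"
    using \<open>0 < t\<close> by simp
  then have "c t * (c (e / t) + (c r - a)) \<in> M" "c t * (c (e / t) - (c r - a)) \<in> M"
    using assms by (auto simp: near_def intro!: scale_mem)
  moreover have "c t * c (e / t) = c e"
    using \<open>0 < t\<close> by (simp flip: c_mult)
  ultimately show "c e + (c (t * r) - c t * a) \<in> M \<and> c e - (c (t * r) - c t * a) \<in> M"
    by (simp add: c_mult algebra_simps)
qed

lemma near_scale: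
  assumes "near a r"
  shows "near (c t * a) (t * r)"
proof (cases t "0::real" rule: linorder_cases)
  case less
  then have "near (c (- t) * - a) (- t * - r)"
    using assms by (intro near_scale_pos near_minus) auto
  then show ?thesis
    by (simp add: c_minus)
next
  case equal
  then show ?thesis
    using near_c[of 0] by (simp add: c_zero)
next
  case greater
  then show ?thesis
    using assms near_scale_pos by blast
qed

text \<open>The upper bound cannot come from multiplying \<open>c d - a\<close> and
  \<open>c d + a\<close>, as \<open>M\<close> need not be closed under products. Weighting each
  factor by the square of the other gives \<open>2 * d\<close> times the difference of squares, and
  the constant is divided out.\<close>

lemma near_square_zero:
  assumes "near a 0"
  shows "near (a\<^sup>2) 0"
  unfolding near_def
proof (intro allI impI conjI)
  fix e :: real
  assume "0 < e"
  have "a\<^sup>2 \<in> M"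
    using square_mem[OF one_mem, of a] by simp
  then show "c e - (c 0 - a\<^sup>2) \<in> M"
    using \<open>0 < e\<close> c_mem_iff[of e] add_mem by (simp add: c_zero)
  define d where "d = sqrt e"
  have d: "0 < d" "e = d * d"
    using \<open>0 < e\<close> by (simp_all add: d_def)
  have "c (1 / (2 * d)) * ((c d + a)\<^sup>2 * (c d - a) + (c d - a)\<^sup>2 * (c d + a)) \<in> M"
    using near_upper[OF assms d(1)] near_lower[OF assms d(1)] d(1)
    by (intro scale_mem add_mem[of "_ * _"] square_mem) (simp_all add: c_zero)
  also have "(c d + a)\<^sup>2 * (c d - a) + (c d - a)\<^sup>2 * (c d + a) = c (2 * d) * (c d * c d - a\<^sup>2)"
    using c_add[of d d] by (simp add: power2_eq_square algebra_simps)
  also have "c (1 / (2 * d)) * (c (2 * d) * (c d * c d - a\<^sup>2)) = c (1 / (2 * d) * (2 * d)) * (c d * c d - a\<^sup>2)"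
    by (simp only: c_mult[of "1 / (2 * d)"] mult.assoc)
  also have "\<dots> = c e + (c 0 - a\<^sup>2)"
  proof -
    have "c (1 / (2 * d) * (2 * d)) = 1" "c e = c d * c d"
      using d c_one by (simp_all add: c_mult)
    then show ?thesis
      by (simp add: c_zero)
  qed
  finally show "c e + (c 0 - a\<^sup>2) \<in> M" .
qed

text \<open>Expand the square around \<open>r\<close>: with the infinitesimal
  \<open>?b = a - c r\<close>, the square of \<open>a\<close> is
  \<open>?b\<^sup>2 + 2 * r * ?b + r\<^sup>2\<close>.\<close>

lemma near_square:
  assumes "near a r"
  shows "near (a\<^sup>2) (r\<^sup>2)"
proof -
  let ?b = "a - c r"
  have "near ?b 0"
    using assms near_iff_zero by blast
  then have "near (?b\<^sup>2 + (c (2 * r) * ?b + c (r\<^sup>2))) (0 + (2 * r * 0 + r\<^sup>2))"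
    by (intro near_add near_square_zero near_scale near_c)
  moreover have "?b\<^sup>2 + (c (2 * r) * ?b + c (r\<^sup>2)) = a\<^sup>2"
    using c_add[of r r] by (simp add: power2_eq_square c_mult algebra_simps)
  ultimately show ?thesis
    by simp
qed

text \<open>Polarisation: a product is half of the square of the sum minus both squares.\<close>

lemma near_mult:
  assumes "near a r" "near b s"
  shows "near (a * b) (r * s)"
proof -
  let ?d = "(a + b)\<^sup>2 + (- (a\<^sup>2) + - (b\<^sup>2))"
  have "near (c (1 / 2) * ?d) (1 / 2 * ((r + s)\<^sup>2 + (- (r\<^sup>2) + - (s\<^sup>2))))"
    using assms by (intro near_scale near_add near_minus near_square)
  moreover have "c (1 / 2) * ?d = (c (1 / 2) + c (1 / 2)) * (a * b)"
    by (simp add: power2_eq_square algebra_simps)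
  then have "c (1 / 2) * ?d = a * b"
    by (simp add: c_one flip: c_add)
  moreover have "1 / 2 * ((r + s)\<^sup>2 + (- (r\<^sup>2) + - (s\<^sup>2))) = r * s"
    by (simp add: power2_eq_square algebra_simps)
  ultimately show ?thesis
    by simp
qed

lemma near_sum:
  assumes "\<And>i. i \<in> I \<Longrightarrow> near (a i) (r i)"
  shows "near (\<Sum>i\<in>I. a i) (\<Sum>i\<in>I. r i)"
  using assms near_c[of 0] by (induction I rule: infinite_finite_induct) (auto simp: c_zero near_add)

lemma near_prod:
  assumes "\<And>i. i \<in> I \<Longrightarrow> near (a i) (r i)"
  shows "near (\<Prod>i\<in>I. a i) (\<Prod>i\<in>I. r i)"
  using assms near_c[of 1] by (induction I rule: infinite_finite_induct) (auto simp: c_one near_mult)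

lemma near_power: "near a r \<Longrightarrow> near (a ^ k) (r ^ k)"
  using near_c[of 1] by (induction k) (auto simp: c_one near_mult)

lemma near_nonneg:
  assumes "near a r" "a \<in> M"
  shows "0 \<le> r"
proof -
  have "0 \<le> e + r" if "0 < e" for e
  proof -
    have "c e + (c r - a) + a \<in> M"
      using assms that by (intro add_mem[of "_ + (_ - _)"] near_upper)
    then show ?thesis
      using c_mem_iff[of "e + r"] by (simp add: c_add)
  qed
  \<comment> \<open>For negative \<open>r\<close> this choice of \<open>e\<close> is positive and
    would make \<open>r / 2\<close> nonnegative.\<close>
  from this[of "- r / 2"] show ?thesis
    by (cases "r < 0") auto
qed

text \<open>The value is the infimum of the constants above \<open>a\<close>. Constants below the
  infimum are not above \<open>a\<close>, so totality places them below \<open>a\<close>.\<close>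

lemma near_exists: "\<exists>r. near a r"
proof -
  define R where "R = {r. c r - a \<in> M}"
  have "R \<noteq> {}"
    using bounded[of a] by (auto simp: R_def)
  obtain B where B: "c B - (- a) \<in> M"
    using bounded by blast
  have lower: "- B \<le> r" if "r \<in> R" for r
  proof -
    have "c r - a + (c B - (- a)) \<in> M"
      using that B by (intro add_mem) (auto simp: R_def)
    then show ?thesis
      using c_mem_iff[of "r + B"] by (simp add: c_add)
  qed
  then have "bdd_below R"
    by (rule bdd_belowI)
  have "near a (Inf R)"
    unfolding near_def
  proof (intro allI impI conjI)
    fix e :: real
    assume "0 < e"
    obtain r where r: "r \<in> R" "r < Inf R + e"
      using cInf_lessD[OF \<open>R \<noteq> {}\<close>, of "Inf R + e"] \<open>0 < e\<close> by auto
    have "c (e + Inf R - r) + (c r - a) \<in> M"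
      using r by (intro add_mem) (auto simp: R_def c_mem_iff)
    then show "c e + (c (Inf R) - a) \<in> M"
      by (simp add: c_add c_diff algebra_simps)
    have "Inf R - e \<notin> R"
      using cInf_lower[OF _ \<open>bdd_below R\<close>, of "Inf R - e"] \<open>0 < e\<close> by auto
    then have "- (c (Inf R - e) - a) \<in> M"
      using total unfolding R_def by blast
    then show "c e - (c (Inf R) - a) \<in> M"
      by (simp add: c_diff algebra_simps)
  qed
  then show ?thesis ..
qed

end

section \<open>Polynomials and evaluation\<close>

text \<open>Splits a monomial into a constant and powers of variables, so that values found for the
  variables determine those of all polynomials.\<close>

lemma single_eq_prod_variables:
  fixes m :: "'n::finite \<Rightarrow>\<^sub>0 nat"
  shows "(Poly_Mapping.single m r :: 'n mpoly) =
    Poly_Mapping.single 0 r * (\<Prod>i\<in>UNIV. Poly_Mapping.single (Poly_Mapping.single i 1) 1 ^ Poly_Mapping.lookup m i)"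
proof -
  have power: "(Poly_Mapping.single k 1 :: 'n mpoly) ^ e = Poly_Mapping.single (\<Sum>_<e. k) 1"
    for k :: "'n \<Rightarrow>\<^sub>0 nat" and e
    by (induction e) (auto simp: mult_single add.commute)
  have prod: "(\<Prod>i\<in>I. Poly_Mapping.single (k i) 1 :: 'n mpoly) = Poly_Mapping.single (\<Sum>i\<in>I. k i) 1"
    if "finite I" for I :: "'n set" and k
    using that by (induction I) (auto simp: mult_single)
  have "(\<Sum>i\<in>UNIV. \<Sum>_<Poly_Mapping.lookup m i. Poly_Mapping.single i 1) = m"
    by (rule poly_mapping_eqI)
      (simp add: lookup_sum lookup_single when_def if_distrib cong: if_cong)
  then show ?thesis
    by (simp add: power prod mult_single)
qed

lemma eq_sum_single: "p = (\<Sum>m\<in>Poly_Mapping.keys p. Poly_Mapping.single m (Poly_Mapping.lookup p m))"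
  by (rule poly_mapping_eqI)
    (auto simp: lookup_sum lookup_single when_def in_keys_iff if_distrib cong: if_cong)

text \<open>Terms may cancel in \<open>p + q\<close>, so evaluations are compared over a common
  finite set of exponents, where absent ones contribute zero.\<close>

lemma poly_eval_superset:
  assumes "finite A" "Poly_Mapping.keys p \<subseteq> A"
  shows "poly_eval x p =
    (\<Sum>m\<in>A. Poly_Mapping.lookup p m * (\<Prod>i\<in>UNIV. (x $ i) ^ Poly_Mapping.lookup m i))"
  unfolding poly_eval_def using assms
  by (intro sum.mono_neutral_left) (auto simp: in_keys_iff)

lemma poly_eval_add: "poly_eval x (p + q) = poly_eval x p + poly_eval x q"
proof -
  let ?A = "Poly_Mapping.keys p \<union> Poly_Mapping.keys q"
  have "finite ?A" "Poly_Mapping.keys (p + q) \<subseteq> ?A"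
    using Poly_Mapping.keys_add[of p q] by simp_all
  then show ?thesis
    by (simp add: poly_eval_superset[of ?A] lookup_add distrib_right sum.distrib)
qed

lemma poly_eval_single:
  "poly_eval x (Poly_Mapping.single m r) = r * (\<Prod>i\<in>UNIV. (x $ i) ^ Poly_Mapping.lookup m i)"
  by (simp add: poly_eval_superset[of "{m}"])

lemma poly_eval_zero: "poly_eval x 0 = 0"
  by (simp add: poly_eval_def)

lemma poly_eval_const: "poly_eval x (Poly_Mapping.single 0 r) = r"
  by (simp add: poly_eval_single)

lemma poly_eval_one: "poly_eval x 1 = 1"
  using poly_eval_const[of x 1] by simp

lemma poly_eval_minus: "poly_eval x (- p) = - poly_eval x p"
  using poly_eval_add[of x p "- p"] by (simp add: poly_eval_zero)

lemma poly_eval_sum: "poly_eval x (\<Sum>i\<in>I. p i) = (\<Sum>i\<in>I. poly_eval x (p i))"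
  by (induction I rule: infinite_finite_induct) (auto simp: poly_eval_zero poly_eval_add)

text \<open>Both sides are biadditive, which reduces the claim to monomials.\<close>

lemma poly_eval_mult: "poly_eval x (p * q) = poly_eval x p * poly_eval x q"
proof -
  let ?p = "\<lambda>m. Poly_Mapping.single m (Poly_Mapping.lookup p m)"
  let ?q = "\<lambda>m. Poly_Mapping.single m (Poly_Mapping.lookup q m)"
  have single: "poly_eval x (Poly_Mapping.single m r * Poly_Mapping.single k s) =
    poly_eval x (Poly_Mapping.single m r) * poly_eval x (Poly_Mapping.single k s)" for m k r s
    by (simp add: mult_single poly_eval_single lookup_add power_add prod.distrib)
  have "poly_eval x ((\<Sum>m\<in>Poly_Mapping.keys p. ?p m) * (\<Sum>m\<in>Poly_Mapping.keys q. ?q m)) =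
    poly_eval x (\<Sum>m\<in>Poly_Mapping.keys p. ?p m) * poly_eval x (\<Sum>m\<in>Poly_Mapping.keys q. ?q m)"
    by (simp only: sum_product poly_eval_sum single)
  then show ?thesis
    by (simp only: eq_sum_single[symmetric])
qed

theorem archimedean_square_cone_point:
  fixes M :: "'n::finite mpoly set"
  assumes cone: "square_cone M" and proper: "- 1 \<notin> M"
    and bounded: "\<And>a. \<exists>B. Poly_Mapping.single 0 B - a \<in> M"
  obtains x where "\<And>a. a \<in> M \<Longrightarrow> 0 \<le> poly_eval x a"
proof -
  obtain N where N: "square_cone N" "M \<subseteq> N" "- 1 \<notin> N"
    and maximal: "\<And>L. square_cone L \<Longrightarrow> N \<subseteq> L \<Longrightarrow> - 1 \<notin> L \<Longrightarrow> L = N"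
    using exists_maximal_square_cone[OF cone proper] by metis
  have "2 * (Poly_Mapping.single 0 (1 / 2) :: 'n mpoly) = 1"
    by (simp add: mult_2 flip: single_add)
  note total = square_cone.maximal_total[OF N(1) this N(3) maximal]
  interpret total_archimedean_cone N "Poly_Mapping.single 0"
  proof (intro total_archimedean_cone.intro[OF N(1)] total_archimedean_cone_axioms.intro)
    show "\<exists>B. Poly_Mapping.single 0 B - a \<in> N" for a
      using bounded N(2) by blast
  qed (use N(3) total in \<open>auto simp: single_add mult_single\<close>)
  have "\<exists>r. near (Poly_Mapping.single (Poly_Mapping.single i 1) 1) r" for i :: 'n
    by (rule near_exists)
  then obtain r where r: "\<And>i :: 'n. near (Poly_Mapping.single (Poly_Mapping.single i 1) 1) (r i)"
    by metis
  \<comment> \<open>The coordinates are the reals infinitely close to the variables. Compatibility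
    of \<open>near\<close> with sums and products then makes every \<open>p\<close> close to its
    value at \<open>x\<close>.\<close>
  define x where "x = (\<chi> i. r i)"
  have "near p (poly_eval x p)" for p
  proof -
    have "near (\<Sum>m\<in>Poly_Mapping.keys p. Poly_Mapping.single m (Poly_Mapping.lookup p m)) (poly_eval x p)"
      unfolding poly_eval_def
    proof (rule near_sum)
      fix m
      show "near (Poly_Mapping.single m (Poly_Mapping.lookup p m))
        (Poly_Mapping.lookup p m * (\<Prod>i\<in>UNIV. (x $ i) ^ Poly_Mapping.lookup m i))"
        by (subst single_eq_prod_variables)
          (auto simp: x_def intro!: near_mult near_c near_prod near_power r[simplified])
    qed
    then show ?thesis
      by (simp flip: eq_sum_single)
  qed
  then have "0 \<le> poly_eval x a" if "a \<in> M" for a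
    using near_nonneg N(2) that by blast
  then show thesis
    by (rule that)
qed

section \<open>Quadratic modules of matrix polynomials\<close>

lemma matrix_add_rdistrib':
  fixes A B :: "'a::comm_ring_1^'n^'m"
  shows "(A + B) ** C = A ** C + B ** C"
  by (simp add: matrix_matrix_mult_def vec_eq_iff distrib_right sum.distrib)

lemma congruence_minus:
  fixes P A :: "'a::comm_ring_1^'n^'n"
  shows "transpose P ** (- A) ** P = - (transpose P ** A ** P)"
  by (simp add: matrix_matrix_mult_def vec_eq_iff sum_negf)

lemma congruence_add:
  fixes P A :: "'a::comm_ring_1^'n^'n"
  shows "transpose P ** (A + B) ** P = transpose P ** A ** P + transpose P ** B ** P"
  by (simp add: matrix_add_ldistrib matrix_add_rdistrib')

lemma congruence_zero: "transpose P ** (0 :: 'a::comm_ring_1^'n^'n) ** P = 0"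
  by (simp add: matrix_matrix_mult_def vec_eq_iff)

lemma congruence_sum:
  fixes P :: "'a::comm_ring_1^'n^'n"
  shows "transpose P ** (\<Sum>i\<in>I. A i) ** P = (\<Sum>i\<in>I. transpose P ** A i ** P)"
  by (induction I rule: infinite_finite_induct) (auto simp: congruence_add congruence_zero)

lemma congruence_compose:
  fixes P Q A :: "'a::comm_ring_1^'n^'n"
  shows "transpose P ** (transpose Q ** A ** Q) ** P = transpose (Q ** P) ** A ** (Q ** P)"
  by (simp add: matrix_transpose_mul matrix_mul_assoc)

lemma mat_mult_mat: "(mat a ** mat b :: 'a::comm_ring_1^'n^'n) = mat (a * b)"
proof -
  have "(\<Sum>k\<in>UNIV. (if i = k then a else 0) * (if k = j then b else 0)) = (if i = j then a * b else 0)" for i j :: 'n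
    by (subst sum.mono_neutral_right[of _ "{i}"]) auto
  then show ?thesis
    by (simp add: mat_def matrix_matrix_mult_def vec_eq_iff)
qed

lemma mat_add: "mat (a + b) = (mat a + mat b :: 'a::comm_ring_1^'n^'n)"
  and mat_diff: "mat (a - b) = (mat a - mat b :: 'a::comm_ring_1^'n^'n)"
  by (simp_all add: mat_def vec_eq_iff)

text \<open>The matrix counterpart of \<open>square_cone\<close>: congruence replaces multiplication
  by squares, and properness is again left out.\<close>

locale congruence_cone =
  fixes K :: "('a::comm_ring_1^'t::finite^'t) set"
  assumes one_mem: "mat 1 \<in> K"
    and add_mem: "A \<in> K \<Longrightarrow> B \<in> K \<Longrightarrow> A + B \<in> K"
    and congruence_mem: "A \<in> K \<Longrightarrow> transpose P ** A ** P \<in> K"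
begin

lemma zero_mem: "0 \<in> K"
  using congruence_mem[OF one_mem, of 0] by (simp add: matrix_matrix_mult_def zero_vec_def)

lemma sum_mem: "(\<And>i. i \<in> I \<Longrightarrow> A i \<in> K) \<Longrightarrow> (\<Sum>i\<in>I. A i) \<in> K"
  by (induction I rule: infinite_finite_induct) (auto simp: zero_mem add_mem)

text \<open>Passes from matrices to the commutative setting, since congruence by
  \<open>mat q\<close> multiplies a scalar matrix by the square of \<open>q\<close>.\<close>

lemma square_cone_scalars: "square_cone {a. mat a \<in> K}"
proof
  show "1 \<in> {a. mat a \<in> K}"
    using one_mem by simp
  show "a + b \<in> {a. mat a \<in> K}" if "a \<in> {a. mat a \<in> K}" "b \<in> {a. mat a \<in> K}" for a b
    using that add_mem by (simp add: mat_add)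
  show "q\<^sup>2 * a \<in> {a. mat a \<in> K}" if "a \<in> {a. mat a \<in> K}" for a q
  proof -
    have "(mat (q\<^sup>2 * a) :: 'a^'t^'t) = transpose (mat q) ** mat a ** mat q"
      by (simp add: transpose_mat mat_mult_mat power2_eq_square ac_simps)
    then show ?thesis
      using congruence_mem[of "mat a" "mat q"] that by (simp only: mem_Collect_eq)
  qed
qed

lemma quadratic_form_mem:
  assumes "A \<in> K"
  shows "mat (\<Sum>i\<in>UNIV. \<Sum>k\<in>UNIV. v i * A $ i $ k * v k) \<in> K"
proof -
  \<comment> \<open>\<open>P j\<close> has \<open>v\<close> as its column \<open>j\<close>, so
    congruence by it leaves only the value of the quadratic form, at diagonal place
    \<open>j\<close>. Summing over \<open>j\<close> fills the diagonal.\<close>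
  define P :: "'t \<Rightarrow> 'a^'t^'t" where "P j = (\<chi> i k. if k = j then v i else 0)" for j
  let ?a = "\<Sum>i\<in>UNIV. \<Sum>k\<in>UNIV. v i * A $ i $ k * v k"
  have "(transpose (P j) ** A ** P j) $ r $ s = (if r = j \<and> s = j then ?a else 0)" for j r s
  proof -
    have "(transpose (P j) ** A ** P j) $ r $ s =
      (\<Sum>k\<in>UNIV. (\<Sum>i\<in>UNIV. P j $ i $ r * A $ i $ k) * P j $ k $ s)"
      by (simp add: matrix_matrix_mult_def transpose_def)
    also have "\<dots> = (if r = j \<and> s = j then \<Sum>k\<in>UNIV. \<Sum>i\<in>UNIV. v i * A $ i $ k * v k else 0)"
      by (auto simp: P_def sum_distrib_right)
    finally show ?thesis
      by (subst (asm) sum.swap)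
  qed
  then have "(\<Sum>j\<in>UNIV. transpose (P j) ** A ** P j) $ r $ s = (\<Sum>j\<in>UNIV. if j = r then (if s = r then ?a else 0) else 0)" for r s
    unfolding sum_component by (intro sum.cong) auto
  then have "(\<Sum>j\<in>UNIV. transpose (P j) ** A ** P j) = mat ?a"
    by (auto simp: vec_eq_iff mat_def)
  moreover have "(\<Sum>j\<in>UNIV. transpose (P j) ** A ** P j) \<in> K"
    using assms by (intro sum_mem congruence_mem)
  ultimately show ?thesis
    by simp
qed

end

section \<open>The quadratic module generated by a set of matrices\<close>

lemma sum_append:
  fixes F :: "'b \<Rightarrow> 'a::comm_monoid_add" and m n :: nat
  shows "(\<Sum>i=1..m. F (u i)) + (\<Sum>i=1..n. F (w i)) =
    (\<Sum>i=1..m + n. F (if i \<le> m then u i else w (i - m)))"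
proof -
  have "(\<Sum>i=1..m + n. F (if i \<le> m then u i else w (i - m))) =
    (\<Sum>i=1..m. F (u i)) + (\<Sum>i=m + 1..m + n. F (if i \<le> m then u i else w (i - m)))"
    using sum.ub_add_nat[of 1 m "\<lambda>i. F (if i \<le> m then u i else w (i - m))" n] by simp
  also have "(\<Sum>i=m + 1..m + n. F (if i \<le> m then u i else w (i - m))) = (\<Sum>i=1..n. F (w i))"
    by (rule sum.reindex_bij_witness[of _ "\<lambda>i. i + m" "\<lambda>i. i - m"]) auto
  finally show ?thesis ..
qed

lemma congruence_cone_quadratic_module: "congruence_cone (quadratic_module G)"
proof
  \<comment> \<open>Pairing generator and multiplier turns a representation into a single family, so
    two representations can be concatenated by \<open>sum_append\<close>.\<close>
  let ?F = "\<lambda>(g, p). transpose p ** g ** p"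
  have eq: "A \<in> quadratic_module G \<longleftrightarrow>
    (\<exists>N u. 1 \<le> N \<and> (\<forall>i\<in>{1..N::nat}. fst (u i) \<in> insert (mat 1) G) \<and> A = (\<Sum>i=1..N. ?F (u i)))" for A
  proof
    assume "A \<in> quadratic_module G"
    then obtain N :: nat and g p where "1 \<le> N" "\<forall>i\<in>{1..N}. g i \<in> insert (mat 1) G"
      "A = (\<Sum>i=1..N. transpose (p i) ** g i ** p i)"
      by (auto simp: quadratic_module_def)
    then show "\<exists>N u. 1 \<le> N \<and> (\<forall>i\<in>{1..N::nat}. fst (u i) \<in> insert (mat 1) G) \<and> A = (\<Sum>i=1..N. ?F (u i))"
      by (intro exI[of _ N] exI[of _ "\<lambda>i. (g i, p i)"]) auto
  next
    assume "\<exists>N u. 1 \<le> N \<and> (\<forall>i\<in>{1..N::nat}. fst (u i) \<in> insert (mat 1) G) \<and> A = (\<Sum>i=1..N. ?F (u i))"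
    then obtain N :: nat and u where "1 \<le> N" "\<forall>i\<in>{1..N}. fst (u i) \<in> insert (mat 1) G"
      "A = (\<Sum>i=1..N. ?F (u i))"
      by blast
    then show "A \<in> quadratic_module G"
      unfolding quadratic_module_def mem_Collect_eq
      by (intro exI[of _ N] exI[of _ "fst \<circ> u"] exI[of _ "snd \<circ> u"]) (auto simp: case_prod_beta)
  qed
  show "mat 1 \<in> quadratic_module G"
    unfolding eq by (intro exI[of _ 1] exI[of _ "\<lambda>_. (mat 1, mat 1)"]) auto
  show "A + B \<in> quadratic_module G" if "A \<in> quadratic_module G" "B \<in> quadratic_module G" for A B
  proof -
    obtain m u where u: "1 \<le> m" "\<forall>i\<in>{1..m::nat}. fst (u i) \<in> insert (mat 1) G" "A = (\<Sum>i=1..m. ?F (u i))"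
      using \<open>A \<in> _\<close> unfolding eq by blast
    obtain n w where w: "1 \<le> n" "\<forall>i\<in>{1..n::nat}. fst (w i) \<in> insert (mat 1) G" "B = (\<Sum>i=1..n. ?F (w i))"
      using \<open>B \<in> _\<close> unfolding eq by blast
    let ?z = "\<lambda>i. if i \<le> m then u i else w (i - m)"
    have "fst (?z i) \<in> insert (mat 1) G" if "i \<in> {1..m + n}" for i
    proof (cases "i \<le> m")
      case True
      then show ?thesis
        using that u(2) by auto
    next
      case False
      then have "i - m \<in> {1..n}"
        using that by auto
      then show ?thesis
        using False w(2) by auto
    qed
    moreover have "A + B = (\<Sum>i=1..m + n. ?F (?z i))"
      unfolding u(3) w(3) by (rule sum_append)
    ultimately show ?thesis
      unfolding eq using u(1) by (intro exI[of _ "m + n"] exI[of _ ?z]) auto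
  qed
  show "transpose P ** A ** P \<in> quadratic_module G" if A: "A \<in> quadratic_module G" for A P
  proof -
    obtain m u where u: "1 \<le> m" "\<forall>i\<in>{1..m::nat}. fst (u i) \<in> insert (mat 1) G" "A = (\<Sum>i=1..m. ?F (u i))"
      using A unfolding eq by (elim exE conjE) (rule that)
    have "transpose P ** A ** P = (\<Sum>i=1..m. ?F (fst (u i), snd (u i) ** P))"
      unfolding u(3) congruence_sum by (simp add: case_prod_beta congruence_compose)
    then show ?thesis
      unfolding eq using u(1,2) by (intro exI[of _ m] exI[of _ "\<lambda>i. (fst (u i), snd (u i) ** P)"]) auto
  qed
qed

lemma generator_mem_quadratic_module:
  assumes "g \<in> G"
  shows "g \<in> quadratic_module G"
  unfolding quadratic_module_def mem_Collect_eq using assms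
  by (intro exI[of _ 1] exI[of _ "\<lambda>_. g"] exI[of _ "\<lambda>_. mat 1"]) auto

section \<open>Evaluation of matrix polynomials and their quadratic forms\<close>

lemma matrix_eval_add: "matrix_eval (A + B) x = matrix_eval A x + matrix_eval B x"
  by (simp add: matrix_eval_def map_matrix_def vec_eq_iff poly_eval_add)

lemma matrix_eval_minus: "matrix_eval (- A) x = - matrix_eval A x"
  by (simp add: matrix_eval_def map_matrix_def vec_eq_iff poly_eval_minus)

lemma matrix_eval_mult: "matrix_eval (A ** B) x = matrix_eval A x ** matrix_eval B x"
  by (simp add: matrix_eval_def map_matrix_def vec_eq_iff matrix_matrix_mult_def poly_eval_sum poly_eval_mult)

lemma matrix_eval_transpose: "matrix_eval (transpose A) x = transpose (matrix_eval A x)"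
  by (simp add: matrix_eval_def map_matrix_def vec_eq_iff transpose_def)

lemma matrix_eval_one: "matrix_eval (mat 1) x = mat 1"
  by (simp add: matrix_eval_def map_matrix_def vec_eq_iff mat_def poly_eval_one poly_eval_zero)

lemma matrix_eval_zero: "matrix_eval 0 x = 0"
  by (simp add: matrix_eval_def map_matrix_def vec_eq_iff poly_eval_zero)

lemma matrix_eval_sum: "matrix_eval (\<Sum>i\<in>I. A i) x = (\<Sum>i\<in>I. matrix_eval (A i) x)"
  by (induction I rule: infinite_finite_induct) (auto simp: matrix_eval_zero matrix_eval_add)

text \<open>Matches the polynomial of \<open>quadratic_form_mem\<close> for a constant vector, which
  transfers positivity from scalar to matrix polynomials.\<close>

lemma quadratic_form_eval:
  "v \<bullet> (matrix_eval A x *v v) =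
    poly_eval x (\<Sum>i\<in>UNIV. \<Sum>k\<in>UNIV. Poly_Mapping.single 0 (v $ i) * A $ i $ k * Poly_Mapping.single 0 (v $ k))"
  by (simp add: poly_eval_sum poly_eval_mult poly_eval_const inner_vec_def matrix_vector_mult_def
      matrix_eval_def map_matrix_def sum_distrib_left mult.assoc)

lemma congruence_quadratic_form:
  fixes A P :: "real^'t::finite^'t"
  shows "v \<bullet> ((transpose P ** A ** P) *v v) = (P *v v) \<bullet> (A *v (P *v v))"
proof -
  have "v \<bullet> ((transpose P ** A ** P) *v v) = v \<bullet> (transpose P *v (A *v (P *v v)))"
    by (simp only: matrix_vector_mul_assoc matrix_mul_assoc)
  also have "\<dots> = (v v* transpose P) \<bullet> (A *v (P *v v))"
    by (simp only: dot_lmul_matrix)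
  also have "v v* transpose P = P *v v"
    by (metis transpose_matrix_vector transpose_transpose)
  finally show ?thesis .
qed

lemma quadratic_form_congruence_sum:
  fixes v :: "real^'t::finite"
  shows "v \<bullet> (matrix_eval (\<Sum>i\<in>I. transpose (p i) ** g i ** p i) x *v v) =
    (\<Sum>i\<in>I. (matrix_eval (p i) x *v v) \<bullet> (matrix_eval (g i) x *v (matrix_eval (p i) x *v v)))"
proof -
  have "(\<Sum>i\<in>I. B i) *v v = (\<Sum>i\<in>I. B i *v v)" for B :: "_ \<Rightarrow> real^'t^'t"
    by (induction I rule: infinite_finite_induct) (auto simp: matrix_vector_mult_add_rdistrib)
  then show ?thesis
    by (simp only: matrix_eval_sum inner_sum_right matrix_eval_mult matrix_eval_transpose
        congruence_quadratic_form)
qed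

text \<open>Each summand contributes the form of a generator at the vector
  \<open>matrix_eval (p i) x *v v\<close>.\<close>

lemma quadratic_module_nonneg:
  assumes "x \<in> nonneg_set G" "A \<in> quadratic_module G"
  shows "0 \<le> v \<bullet> (matrix_eval A x *v v)"
proof -
  obtain N :: nat and g p where g: "\<forall>i\<in>{1..N}. g i \<in> insert (mat 1) G"
    and A: "A = (\<Sum>i=1..N. transpose (p i) ** g i ** p i)"
    using assms(2) by (auto simp: quadratic_module_def)
  have "0 \<le> w \<bullet> (matrix_eval h x *v w)" if "h \<in> insert (mat 1) G" for h w
    using that assms(1) by (auto simp: nonneg_set_def pos_semidef_def matrix_eval_one)
  then show ?thesis
    unfolding A quadratic_form_congruence_sum using g by (intro sum_nonneg) auto
qed

theorem archimedean_congruence_cone_point: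
  fixes K :: "('n::finite, 't::finite) mpoly_matrix set"
  assumes cone: "congruence_cone K" and arch: "archimedean_module K" and proper: "- mat 1 \<notin> K"
  obtains x where "\<And>A v. A \<in> K \<Longrightarrow> 0 \<le> v \<bullet> (matrix_eval A x *v v)"
proof -
  interpret congruence_cone K
    by (fact cone)
  let ?M = "{a. mat a \<in> K}"
  have sq: "square_cone ?M"
    by (rule square_cone_scalars)
  have "- mat 1 = (mat (- 1) :: ('n, 't) mpoly_matrix)"
    by (simp add: mat_def vec_eq_iff)
  then have "- 1 \<notin> ?M"
    using proper by simp
  have bounded: "\<exists>B. Poly_Mapping.single 0 B - a \<in> ?M" for a
  proof -
    obtain N :: nat where "mat (of_nat N) - transpose (mat a) ** mat a \<in> K"
      using arch unfolding archimedean_module_def by blast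
    moreover have "mat (of_nat N) - transpose (mat a) ** mat a = (mat (of_nat N - a\<^sup>2) :: ('n, 't) mpoly_matrix)"
      by (simp add: transpose_mat mat_mult_mat mat_diff power2_eq_square)
    ultimately have N: "of_nat N - a\<^sup>2 \<in> ?M"
      by simp
    \<comment> \<open>Turns the bound on the square of \<open>a\<close> into one on
      \<open>a\<close>: adding the square of \<open>a - 1/2\<close> cancels the quadratic term and
      leaves \<open>N + 1/4 - a\<close>.\<close>
    define h :: "'n mpoly" where "h = Poly_Mapping.single 0 (1 / 2)"
    have "h + h = 1" and hh: "h * h = Poly_Mapping.single 0 (1 / 4)"
      by (simp_all add: h_def mult_single flip: single_add)
    have "of_nat N - a\<^sup>2 + (a - h)\<^sup>2 * 1 \<in> ?M"
      by (intro square_cone.add_mem[OF sq] N square_cone.square_mem[OF sq] square_cone.one_mem[OF sq])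
    also have "of_nat N - a\<^sup>2 + (a - h)\<^sup>2 * 1 = of_nat N + h * h - (h + h) * a"
      by (simp add: power2_eq_square algebra_simps)
    also have "\<dots> = Poly_Mapping.single 0 (of_nat N + 1 / 4) - a"
      unfolding \<open>h + h = 1\<close> hh by (simp add: single_add)
    finally show ?thesis
      by blast
  qed
  obtain x where x: "\<And>a. a \<in> ?M \<Longrightarrow> 0 \<le> poly_eval x a"
    using archimedean_square_cone_point[OF sq \<open>- 1 \<notin> ?M\<close> bounded] by metis
  show thesis
    by (rule that[of x], unfold quadratic_form_eval, rule x) (simp add: quadratic_form_mem)
qed

section \<open>The equivalence of the two conditions on \<open>f\<close>\<close>

theorem corollary22:
  fixes G :: "('n::finite, 't::finite) mpoly_matrix set"
    and f :: "('n, 't) mpoly_matrix"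
  assumes "G \<subseteq> Sym"
    and "archimedean_module (quadratic_module G)"
    and "f \<in> Sym"
  shows "(\<forall>x\<in>nonneg_set G. \<not> neg_semidef (matrix_eval f x)) \<longleftrightarrow>
         (\<exists>(N::nat) p. (\<Sum>i=1..N. transpose (p i) ** f ** p i)
                         \<in> (\<lambda>m. mat 1 + m) ` quadratic_module G)"
proof
  assume "\<exists>(N::nat) p. (\<Sum>i=1..N. transpose (p i) ** f ** p i) \<in> (\<lambda>m. mat 1 + m) ` quadratic_module G"
  then obtain N :: nat and p m where m: "m \<in> quadratic_module G"
    and eq: "(\<Sum>i=1..N. transpose (p i) ** f ** p i) = mat 1 + m"
    by blast
  show "\<forall>x\<in>nonneg_set G. \<not> neg_semidef (matrix_eval f x)"
  proof (intro ballI notI)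
    fix x
    assume x: "x \<in> nonneg_set G" and neg: "neg_semidef (matrix_eval f x)"
    \<comment> \<open>The all-ones vector serves as a nonzero test vector: at it the form of
      \<open>mat 1 + m\<close> is both nonpositive and at least
      \<open>?v \<bullet> ?v > 0\<close>.\<close>
    let ?v = "1 :: real^'t"
    have "w \<bullet> (matrix_eval f x *v w) \<le> 0" for w
    proof -
      have "(- matrix_eval f x) *v w = - (matrix_eval f x *v w)"
        by (simp add: matrix_vector_mult_def vec_eq_iff sum_negf)
      then show ?thesis
        using neg unfolding neg_semidef_def pos_semidef_def by (metis inner_minus_right neg_0_le_iff_le)
    qed
    then have "?v \<bullet> (matrix_eval (mat 1 + m) x *v ?v) \<le> 0"
      unfolding eq[symmetric] quadratic_form_congruence_sum by (intro sum_nonpos)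
    moreover have "0 \<le> ?v \<bullet> (matrix_eval m x *v ?v)"
      using quadratic_module_nonneg[OF x m] .
    moreover have "0 < ?v \<bullet> ?v"
      by (simp add: vec_eq_iff)
    ultimately show False
      by (simp add: matrix_eval_add matrix_eval_one matrix_vector_mult_add_rdistrib inner_add_right)
  qed
next
  assume no_point: "\<forall>x\<in>nonneg_set G. \<not> neg_semidef (matrix_eval f x)"
  interpret Q: congruence_cone "quadratic_module G"
    by (rule congruence_cone_quadratic_module)
  let ?S = "\<lambda>(N::nat) p. \<Sum>i=1..N. transpose (p i) ** f ** p i"
  \<comment> \<open>This is the quadratic module generated by \<open>G\<close> together with
    \<open>- f\<close>.\<close>
  define K where "K = {m - ?S N p | m N p. m \<in> quadratic_module G}"
  have K_mem: "m - ?S N p \<in> K" if "m \<in> quadratic_module G" for m N p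
    unfolding K_def mem_Collect_eq
    by (rule exI[of _ m], rule exI[of _ N], rule exI[of _ p]) (use that in simp)
  have subset: "quadratic_module G \<subseteq> K"
  proof
    fix m
    assume "m \<in> quadratic_module G"
    \<comment> \<open>With \<open>N = 0\<close> the subtracted sum is empty; the family chosen is
      arbitrary.\<close>
    then have "m - ?S 0 (\<lambda>_. 0) \<in> K"
      by (rule K_mem)
    then show "m \<in> K"
      by simp
  qed
  have "congruence_cone K"
  proof
    show "mat 1 \<in> K"
      using subset Q.one_mem by blast
    show "A + B \<in> K" if "A \<in> K" "B \<in> K" for A B
    proof -
      obtain m N p m' N' p' where *: "m \<in> quadratic_module G" "m' \<in> quadratic_module G"
        "A = m - ?S N p" "B = m' - ?S N' p'"
        using \<open>A \<in> K\<close> \<open>B \<in> K\<close> unfolding K_def by blast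
      have "A + B = (m + m') - (?S N p + ?S N' p')"
        by (simp add: *)
      also have "\<dots> = (m + m') - ?S (N + N') (\<lambda>i. if i \<le> N then p i else p' (i - N))"
        using sum_append[of "\<lambda>p. transpose p ** f ** p" p N p' N'] by simp
      finally show ?thesis
        using K_mem[OF Q.add_mem[OF *(1,2)]] by simp
    qed
    show "transpose P ** A ** P \<in> K" if "A \<in> K" for A P
    proof -
      obtain m N p where *: "m \<in> quadratic_module G" "A = m + - ?S N p"
        using \<open>A \<in> K\<close> unfolding K_def by force
      have "transpose P ** A ** P = transpose P ** m ** P - ?S N (\<lambda>i. p i ** P)"
        unfolding * congruence_add congruence_minus congruence_sum congruence_compose by simp
      then show ?thesis
        using K_mem[OF Q.congruence_mem[OF *(1)]] by simp
    qed
  qed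
  moreover have "archimedean_module K"
    using assms(2) subset unfolding archimedean_module_def by blast
  moreover have "\<not> (\<forall>A\<in>K. \<forall>v. 0 \<le> v \<bullet> (matrix_eval A x *v v))" for x
  proof
    assume nonneg: "\<forall>A\<in>K. \<forall>v. 0 \<le> v \<bullet> (matrix_eval A x *v v)"
    \<comment> \<open>\<open>pos_semidef\<close> includes symmetry, which nonnegative quadratic
      forms do not provide; it is inherited from \<open>G\<close> and \<open>f\<close>.\<close>
    have sym: "matrix_eval A x \<in> Sym" if "A \<in> Sym" for A :: "('n, 't) mpoly_matrix"
      using that by (simp add: Sym_def flip: matrix_eval_transpose)
    have "x \<in> nonneg_set G"
      using nonneg sym assms(1) subset generator_mem_quadratic_module
      unfolding nonneg_set_def pos_semidef_def by blast
    moreover have "0 - ?S 1 (\<lambda>_. mat 1) \<in> K"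
      using Q.zero_mem by (rule K_mem)
    then have "- f \<in> K"
      by simp
    moreover have "- f \<in> Sym"
      using assms(3) by (simp add: Sym_def transpose_def vec_eq_iff)
    ultimately show False
      using no_point nonneg sym[of "- f"] unfolding neg_semidef_def pos_semidef_def
      by (metis matrix_eval_minus)
  qed
  \<comment> \<open>Otherwise some point would make all forms from \<open>K\<close> nonnegative; it
    would lie in \<open>nonneg_set G\<close>, with \<open>f\<close> negative semidefinite
    there.\<close>
  ultimately have "- mat 1 \<in> K"
    using archimedean_congruence_cone_point by metis
  then obtain m N p where m: "m \<in> quadratic_module G" and "- mat 1 = m - ?S N p"
    unfolding K_def by blast
  then have "?S N p = mat 1 + m"
    by (simp add: algebra_simps eq_neg_iff_add_eq_0)
  then show "\<exists>(N::nat) p. (\<Sum>i=1..N. transpose (p i) ** f ** p i) \<in> (\<lambda>m. mat 1 + m) ` quadratic_module G"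
    using m by blast
qed

end
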